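(* Let $n\ge0$ be an integer. The singular part $\mathcal{RP}_n\setminus\mathcal S_n$ of the rook partition monoid satisfies $$\operatorname{rank}(\mathcal{RP}_n\setminus\mathcal S_n)=\operatorname{idrank}(\mathcal{RP}_n\setminus\mathcal S_n)=\frac{n^2+3n}{2}.$$
   Context: Write $[n]=\{1,\dots,n\}$, $[n]'=\{1',\dots,n'\}$, $[n]''=\{1'',\dots,n''\}$. A rook partition of degree $n$ is a collection of pairwise disjoint non-empty subsets (called blocks) of $[n]\cup[n]'$; elements of $[n]\cup[n]'$ lying in no block are its rook dots. $\mathcal{RP}_n$ is the set of all rook partitions of degree $n$. Product: for $\alpha,\beta\in\mathcal{RP}_n$, relabel each $i'$ of $\alpha$ as $i''$ to get $\alpha_\vee$, and relabel each $i$ of $\beta$ as $i''$ to get $\beta^\wedge$. Let $\Gamma(\alpha,\beta)$ be the graph on $[n]\cup[n]'\cup[n]''$ in which two vertices are adjacent if they lie in a common block of $\alpha_\vee$ or a common block of $\beta^\wedge$; a vertex is white if it is a rook dot of $\alpha_\vee$ or of $\beta^\wedge$, and black otherwise. Then $\alpha\beta$ is the rook partition such that $x\in[n]\cup[n]'$ is a rook dot of $\alpha\beta$ iff $x$ is connected by a (possibly empty) path to a white vertex in $\Gamma(\alpha,\beta)$, and two elements of $[n]\cup[n]'$ that are not rook dots of $\alpha\beta$ are in the same block iff they are connected by a path in $\Gamma(\alpha,\beta)$. This makes $\mathcal{RP}_n$ a monoid. A transversal block is one meeting both $[n]$ and $[n]'$; $\mathcal S_n$ is the set of elements with exactly $n$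 transversal blocks (the group of units), and $\mathcal{RP}_n\setminus\mathcal S_n$ is an ideal (empty for $n=0$). The rank of a semigroup is the smallest size of a (semigroup) generating set. If a semigroup is generated by its idempotents, its idempotent rank, $\operatorname{idrank}$, is the smallest size of a generating set consisting entirely of idempotents. *)

theory Defs
  imports Main "HOL-Library.Extended_Nat"
begin

text \<open>The vertices \<open>i\<close>, \<open>i'\<close> and \<open>i''\<close>. Indices run over \<open>{1..n}\<close>.\<close>

datatype vertex = Unprimed nat | Primed nat | DPrimed nat

definition top_row :: "nat \<Rightarrow> vertex set" where
  "top_row n = Unprimed ` {1..n}"

definition bottom_row :: "nat \<Rightarrow> vertex set" where
  "bottom_row n = Primed ` {1..n}"

definition boundary :: "nat \<Rightarrow> vertex set" where
  "boundary n = top_row n \<union> bottom_row n"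

definition rook_partitions :: "nat \<Rightarrow> vertex set set set" where
  "rook_partitions n =
     {\<alpha>. (\<forall>B\<in>\<alpha>. B \<noteq> {} \<and> B \<subseteq> boundary n) \<and> pairwise disjnt \<alpha>}"

definition rook_dots :: "nat \<Rightarrow> vertex set set \<Rightarrow> vertex set" where
  "rook_dots n \<alpha> = boundary n - \<Union>\<alpha>"

fun primed_to_middle :: "vertex \<Rightarrow> vertex" where
  "primed_to_middle (Primed i) = DPrimed i"
| "primed_to_middle v = v"

fun unprimed_to_middle :: "vertex \<Rightarrow> vertex" where
  "unprimed_to_middle (Unprimed i) = DPrimed i"
| "unprimed_to_middle v = v"

text \<open>The adjacency relation of the product graph \<open>\<Gamma>(\<alpha>, \<beta>)\<close>. It contains loops, which do not
  affect connectivity; the paths of the graph are given by its reflexive transitive closure.\<close>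

definition product_graph :: "vertex set set \<Rightarrow> vertex set set \<Rightarrow> (vertex \<times> vertex) set" where
  "product_graph \<alpha> \<beta> =
     {(x, y). \<exists>B \<in> image primed_to_middle ` \<alpha> \<union> image unprimed_to_middle ` \<beta>. x \<in> B \<and> y \<in> B}"

definition white_vertices :: "nat \<Rightarrow> vertex set set \<Rightarrow> vertex set set \<Rightarrow> vertex set" where
  "white_vertices n \<alpha> \<beta> =
     primed_to_middle ` rook_dots n \<alpha> \<union> unprimed_to_middle ` rook_dots n \<beta>"

definition product_dots :: "nat \<Rightarrow> vertex set set \<Rightarrow> vertex set set \<Rightarrow> vertex set" where
  "product_dots n \<alpha> \<beta> =
     {x \<in> boundary n. \<exists>w \<in> white_vertices n \<alpha> \<beta>. (x, w) \<in> (product_graph \<alpha> \<beta>)\<^sup>*}"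

definition rook_mult :: "nat \<Rightarrow> vertex set set \<Rightarrow> vertex set set \<Rightarrow> vertex set set" where
  "rook_mult n \<alpha> \<beta> =
     {{y \<in> boundary n - product_dots n \<alpha> \<beta>. (x, y) \<in> (product_graph \<alpha> \<beta>)\<^sup>*} |x.
        x \<in> boundary n - product_dots n \<alpha> \<beta>}"

lemma sym_product_graph: "sym (product_graph \<alpha> \<beta>)"
  by (auto simp: sym_def product_graph_def)

lemma rook_mult_closed: "rook_mult n \<alpha> \<beta> \<in> rook_partitions n"
proof -
  have s: "(y, x) \<in> (product_graph \<alpha> \<beta>)\<^sup>*" if "(x, y) \<in> (product_graph \<alpha> \<beta>)\<^sup>*" for x y
    using that sym_product_graph sym_rtrancl symD by metis
  have "pairwise disjnt (rook_mult n \<alpha> \<beta>)"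
    unfolding pairwise_def disjnt_def rook_mult_def
    by (auto; meson s rtrancl_trans)
  moreover have "\<forall>B\<in>rook_mult n \<alpha> \<beta>. B \<noteq> {} \<and> B \<subseteq> boundary n"
    by (auto simp: rook_mult_def)
  ultimately show ?thesis by (simp add: rook_partitions_def)
qed

lemma rook_dots_rook_mult: "rook_dots n (rook_mult n \<alpha> \<beta>) = product_dots n \<alpha> \<beta>"
  by (auto simp: rook_dots_def rook_mult_def product_dots_def)

definition transversal_blocks :: "nat \<Rightarrow> vertex set set \<Rightarrow> vertex set set" where
  "transversal_blocks n \<alpha> = {B \<in> \<alpha>. B \<inter> top_row n \<noteq> {} \<and> B \<inter> bottom_row n \<noteq> {}}"

definition rook_units :: "nat \<Rightarrow> vertex set set set" where
  "rook_units n = {\<alpha> \<in> rook_partitions n. card (transversal_blocks n \<alpha>) = n}"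

inductive_set generated_subsemigroup :: "('a \<Rightarrow> 'a \<Rightarrow> 'a) \<Rightarrow> 'a set \<Rightarrow> 'a set"
  for mult :: "'a \<Rightarrow> 'a \<Rightarrow> 'a" and A :: "'a set" where
  generator: "a \<in> A \<Longrightarrow> a \<in> generated_subsemigroup mult A"
| product: "x \<in> generated_subsemigroup mult A \<Longrightarrow> y \<in> generated_subsemigroup mult A
     \<Longrightarrow> mult x y \<in> generated_subsemigroup mult A"

text \<open>A semigroup is given by its multiplication and its carrier. The rank is \<open>\<infinity>\<close> if there is no
  finite generating set; the idempotent rank is \<open>\<infinity>\<close> if there is no finite generating set of
  idempotents, so a finite idempotent rank includes the claim that the semigroup is generated
  by its idempotents. The empty set generates the empty semigroup.\<close>

definition semigroup_rank :: "('a \<Rightarrow> 'a \<Rightarrow> 'a) \<Rightarrow> 'a set \<Rightarrow> enat" where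
  "semigroup_rank mult S =
     Inf {enat (card A) |A. finite A \<and> A \<subseteq> S \<and> generated_subsemigroup mult A = S}"

definition semigroup_idrank :: "('a \<Rightarrow> 'a \<Rightarrow> 'a) \<Rightarrow> 'a set \<Rightarrow> enat" where
  "semigroup_idrank mult S =
     Inf {enat (card A) |A. finite A \<and> A \<subseteq> S \<and> (\<forall>e\<in>A. mult e e = e)
                            \<and> generated_subsemigroup mult A = S}"

end

theory Submission
  imports Defs
begin

text \<open>The generators are the idempotents in which all but one or two columns are vertical edges:
  \<open>cut_top\<close> has the block \<open>{i}\<close> and the rook dot \<open>i'\<close>, \<open>dot_top\<close> is its mirror image, and
  \<open>merge\<close> has the block \<open>{i, j, i', j'}\<close>.

  Lower bound: a rook partition is singular iff its top row has a defect, that is, a rook dot, a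
  non-transversal block, or two points that are not separated. The defects of a left factor are
  inherited by the product, and for each of the \<open>n + n + n (n - 1) / 2\<close> defects there is a generator
  having only that one. Hence every generating set contains, for each defect, an element having
  only that defect.

  Upper bound: describe a rook partition by a labelling of its points, with label \<open>None\<close> for the
  rook dots. Right multiplication by generators merges two labels, kills a label, or overwrites the
  label of a point in the bottom row by \<open>None\<close>, by a fresh label, or by the label of another bottom
  point. Starting from the identity, one first creates the top row of the target. If the target is
  singular, it has fewer than \<open>n\<close> transversal labels, so there is always a spare bottom point,
  which makes it possible to move the transversal labels to their final positions; the
  remaining bottom points are then filled in one by one.\<close>

section \<open>Rook partitions as labellings of the boundary\<close>

text \<open>The label \<open>None\<close> marks the rook dots, so its fibre is the only one that is
  not a block. Other labels matter only through equality, which leaves them free to be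
  renamed.\<close>

definition fibres :: "nat \<Rightarrow> (vertex \<Rightarrow> 'l option) \<Rightarrow> vertex set set" where
  "fibres n f = {{y \<in> boundary n. f y = f x} |x. x \<in> boundary n \<and> f x \<noteq> None}"

lemma fibres_in_rook_partitions: "fibres n f \<in> rook_partitions n"
proof -
  have "disjnt B C" if "B \<in> fibres n f" "C \<in> fibres n f" "B \<noteq> C" for B C
  proof -
    obtain x y where "B = {z \<in> boundary n. f z = f x}" "C = {z \<in> boundary n. f z = f y}"
      using \<open>B \<in> fibres n f\<close> \<open>C \<in> fibres n f\<close> unfolding fibres_def by blast
    with \<open>B \<noteq> C\<close> show ?thesis unfolding disjnt_def by auto
  qed
  moreover have "B \<noteq> {} \<and> B \<subseteq> boundary n" if "B \<in> fibres n f" for B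
    using that unfolding fibres_def by blast
  ultimately show ?thesis by (auto simp: rook_partitions_def pairwise_def)
qed

lemma rook_dots_fibres: "rook_dots n (fibres n f) = {x \<in> boundary n. f x = None}"
proof -
  have "x \<in> \<Union>(fibres n f) \<longleftrightarrow> f x \<noteq> None" if "x \<in> boundary n" for x
  proof
    assume "f x \<noteq> None"
    then have "{y \<in> boundary n. f y = f x} \<in> fibres n f" using that unfolding fibres_def by blast
    then show "x \<in> \<Union>(fibres n f)" using that by blast
  qed (auto simp: fibres_def)
  then show ?thesis unfolding rook_dots_def by blast
qed

text \<open>Blocks depend only on which points are labelled \<open>None\<close> and which points
  share a label. This is the tool for renaming labels and for altering a labelling off the
  boundary.\<close>

lemma fibres_cong:
  assumes "\<And>x. x \<in> boundary n \<Longrightarrow> f x = None \<longleftrightarrow> g x = None"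
    and "\<And>x y. x \<in> boundary n \<Longrightarrow> y \<in> boundary n \<Longrightarrow> f x = f y \<longleftrightarrow> g x = g y"
  shows "fibres n f = fibres n g"
proof -
  have "{y \<in> boundary n. f y = f x} = {y \<in> boundary n. g y = g x}" if "x \<in> boundary n" for x
    using assms(2) that by blast
  then have "B = {y \<in> boundary n. f y = f x} \<and> x \<in> boundary n \<and> f x \<noteq> None \<longleftrightarrow>
      B = {y \<in> boundary n. g y = g x} \<and> x \<in> boundary n \<and> g x \<noteq> None" for B x
    using assms(1)[of x] by (cases "x \<in> boundary n") simp_all
  then show ?thesis
    unfolding fibres_def by simp
qed

text \<open>Each point can be labelled by its own block. The bound on the labels keeps every set
  containing a middle vertex available as a label of another kind.\<close>

lemma rook_partition_as_fibres:
  assumes "\<alpha> \<in> rook_partitions n"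
  obtains f :: "vertex \<Rightarrow> vertex set option"
    where "\<alpha> = fibres n f" "\<And>x B. f x = Some B \<Longrightarrow> B \<subseteq> boundary n"
proof
  \<comment> \<open>The union runs over the one block containing \<open>x\<close>, so it is that
    block, obtained without a choice.\<close>
  define f where "f x = (if x \<in> \<Union>\<alpha> then Some (\<Union>{B \<in> \<alpha>. x \<in> B}) else None)" for x
  have ne: "B \<noteq> {}" and sub: "B \<subseteq> boundary n" if "B \<in> \<alpha>" for B
    using assms that by (auto simp: rook_partitions_def)
  have uniq: "C = B" if "B \<in> \<alpha>" "C \<in> \<alpha>" "x \<in> B" "x \<in> C" for B C x
    using assms that by (auto simp: rook_partitions_def pairwise_def disjnt_def)
  have lab: "f x = Some B" if "B \<in> \<alpha>" "x \<in> B" for x B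
  proof -
    have "{C \<in> \<alpha>. x \<in> C} = {B}" using uniq that by blast
    then show ?thesis using that by (auto simp: f_def)
  qed
  have some: "\<exists>C\<in>\<alpha>. x \<in> C" if "f x \<noteq> None" for x
    using that unfolding f_def by (auto split: if_splits)
  show "B \<subseteq> boundary n" if "f x = Some B" for x B
  proof -
    obtain C where C: "C \<in> \<alpha>" "x \<in> C" using \<open>f x = Some B\<close> some[of x] by auto
    then show ?thesis using lab[OF C] that sub by simp
  qed
  have fib: "{y \<in> boundary n. f y = f x} = B" if B: "B \<in> \<alpha>" "x \<in> B" for x B
  proof (intro equalityI subsetI)
    fix y assume "y \<in> {y \<in> boundary n. f y = f x}"
    then have y: "f y = Some B" using lab[OF B] by simp
    with some[of y] obtain C where C: "C \<in> \<alpha>" "y \<in> C" by auto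
    then show "y \<in> B" using lab[OF C] y by simp
  next
    fix y assume "y \<in> B"
    then show "y \<in> {y \<in> boundary n. f y = f x}" using B sub[of B] lab[of B] by auto
  qed
  show "\<alpha> = fibres n f"
  proof (intro equalityI subsetI)
    fix B assume B: "B \<in> \<alpha>"
    obtain x where x: "x \<in> B" using ne[OF B] by blast
    then have "x \<in> boundary n" "f x \<noteq> None" "B = {y \<in> boundary n. f y = f x}"
      using sub[OF B] lab[OF B x] fib[OF B x] by auto
    then show "B \<in> fibres n f" unfolding fibres_def by blast
  next
    fix B assume "B \<in> fibres n f"
    then obtain x where x: "f x \<noteq> None" "B = {y \<in> boundary n. f y = f x}"
      unfolding fibres_def by blast
    from some[OF x(1)] obtain C where C: "C \<in> \<alpha>" "x \<in> C" by blast
    with fib[OF C] x(2) show "B \<in> \<alpha>" by simp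
  qed
qed

section \<open>Products through labellings of the product graph\<close>

lemma product_graph_leftI:
  assumes "x \<in> boundary n" "y \<in> boundary n" "f x = f y" "f x \<noteq> None"
  shows "(primed_to_middle x, primed_to_middle y) \<in> product_graph (fibres n f) \<beta>"
proof -
  have "{z \<in> boundary n. f z = f x} \<in> fibres n f" using assms by (auto simp: fibres_def)
  moreover have "x \<in> {z \<in> boundary n. f z = f x}" "y \<in> {z \<in> boundary n. f z = f x}"
    using assms by simp_all
  ultimately show ?thesis
    unfolding product_graph_def by (auto intro!: bexI[of _ "primed_to_middle ` {z \<in> boundary n. f z = f x}"])
qed

lemma product_graph_rightI:
  assumes "x \<in> boundary n" "y \<in> boundary n" "f x = f y" "f x \<noteq> None"
  shows "(unprimed_to_middle x, unprimed_to_middle y) \<in> product_graph \<alpha> (fibres n f)"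
proof -
  have "{z \<in> boundary n. f z = f x} \<in> fibres n f" using assms by (auto simp: fibres_def)
  moreover have "x \<in> {z \<in> boundary n. f z = f x}" "y \<in> {z \<in> boundary n. f z = f x}"
    using assms by simp_all
  ultimately show ?thesis
    unfolding product_graph_def by (auto intro!: bexI[of _ "unprimed_to_middle ` {z \<in> boundary n. f z = f x}"])
qed

text \<open>A certificate for a product: \<open>h\<close> labels all three rows. The first four
  hypotheses make \<open>h\<close> constant along edges and \<open>None\<close> at white vertices,
  so paths preserve labels. The last two supply the converse for boundary points: equal labels are
  joined by a path, and \<open>None\<close> is joined to a white vertex.\<close>

lemma rook_mult_fibres:
  assumes left: "\<And>x y. x \<in> boundary n \<Longrightarrow> y \<in> boundary n \<Longrightarrow> f x = f y \<Longrightarrow>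
      h (primed_to_middle x) = h (primed_to_middle y)"
    and left_dot: "\<And>x. x \<in> boundary n \<Longrightarrow> f x = None \<Longrightarrow> h (primed_to_middle x) = None"
    and right: "\<And>x y. x \<in> boundary n \<Longrightarrow> y \<in> boundary n \<Longrightarrow> g x = g y \<Longrightarrow>
      h (unprimed_to_middle x) = h (unprimed_to_middle y)"
    and right_dot: "\<And>x. x \<in> boundary n \<Longrightarrow> g x = None \<Longrightarrow> h (unprimed_to_middle x) = None"
    and conn: "\<And>x y. x \<in> boundary n \<Longrightarrow> y \<in> boundary n \<Longrightarrow> h x = h y \<Longrightarrow> h x \<noteq> None \<Longrightarrow>
      (x, y) \<in> (product_graph (fibres n f) (fibres n g))\<^sup>*"
    and conn_dot: "\<And>x. x \<in> boundary n \<Longrightarrow> h x = None \<Longrightarrow>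
      \<exists>w \<in> white_vertices n (fibres n f) (fibres n g).
        (x, w) \<in> (product_graph (fibres n f) (fibres n g))\<^sup>*"
  shows "rook_mult n (fibres n f) (fibres n g) = fibres n h"
proof -
  let ?G = "product_graph (fibres n f) (fibres n g)"
  have edge: "h x = h y" if "(x, y) \<in> ?G" for x y
  proof -
    have "(\<exists>B \<in> fibres n f. x \<in> primed_to_middle ` B \<and> y \<in> primed_to_middle ` B) \<or>
        (\<exists>B \<in> fibres n g. x \<in> unprimed_to_middle ` B \<and> y \<in> unprimed_to_middle ` B)"
      using that unfolding product_graph_def by auto
    then show ?thesis
    proof (elim disjE bexE conjE imageE)
      fix B u v
      assume "B \<in> fibres n f" "u \<in> B" "v \<in> B" "x = primed_to_middle u" "y = primed_to_middle v"
      then show ?thesis using left[of u v] by (auto simp: fibres_def)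
    next
      fix B u v
      assume "B \<in> fibres n g" "u \<in> B" "v \<in> B" "x = unprimed_to_middle u" "y = unprimed_to_middle v"
      then show ?thesis using right[of u v] by (auto simp: fibres_def)
    qed
  qed
  have path: "h x = h y" if "(x, y) \<in> ?G\<^sup>*" for x y
    using that by induction (auto dest: edge)
  have white: "h w = None" if "w \<in> white_vertices n (fibres n f) (fibres n g)" for w
    using that left_dot right_dot by (auto simp: white_vertices_def rook_dots_fibres)
  have dots: "product_dots n (fibres n f) (fibres n g) = {x \<in> boundary n. h x = None}"
    unfolding product_dots_def using conn_dot path white by (metis (no_types, lifting))
  have "{y \<in> boundary n - product_dots n (fibres n f) (fibres n g). (x, y) \<in> ?G\<^sup>*}
      = {y \<in> boundary n. h y = h x}" if "x \<in> boundary n" "h x \<noteq> None" for x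
  proof (intro Collect_cong)
    fix y
    show "y \<in> boundary n - product_dots n (fibres n f) (fibres n g) \<and> (x, y) \<in> ?G\<^sup>* \<longleftrightarrow>
        y \<in> boundary n \<and> h y = h x"
      unfolding dots using that conn path by (metis (mono_tags, lifting) DiffD1 DiffI mem_Collect_eq)
  qed
  then have "B = {y \<in> boundary n - product_dots n (fibres n f) (fibres n g). (x, y) \<in> ?G\<^sup>*} \<and>
        x \<in> boundary n - product_dots n (fibres n f) (fibres n g) \<longleftrightarrow>
      B = {y \<in> boundary n. h y = h x} \<and> x \<in> boundary n \<and> h x \<noteq> None" for B x
    using dots by auto
  then show ?thesis
    unfolding rook_mult_def fibres_def[of n h] by simp
qed

section \<open>The generators and right multiplication by them\<close>

fun rows :: "(nat \<Rightarrow> 'l option) \<Rightarrow> (nat \<Rightarrow> 'l option) \<Rightarrow> vertex \<Rightarrow> 'l option" where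
  "rows a b (Unprimed k) = a k"
| "rows a b (Primed k) = b k"
| "rows a b (DPrimed k) = None"

lemma boundaryE:
  assumes "x \<in> boundary n"
  obtains k where "k \<in> {1..n}" "x = Unprimed k" | k where "k \<in> {1..n}" "x = Primed k"
  using assms by (auto simp: boundary_def top_row_def bottom_row_def)

lemma in_boundary [simp]:
  "Unprimed k \<in> boundary n \<longleftrightarrow> 1 \<le> k \<and> k \<le> n"
  "Primed k \<in> boundary n \<longleftrightarrow> 1 \<le> k \<and> k \<le> n"
  "DPrimed k \<notin> boundary n"
  by (auto simp: boundary_def top_row_def bottom_row_def)

text \<open>As a row, \<open>Some\<close> gives column \<open>k\<close> the label \<open>k\<close>;
  used in both rows it yields vertical edges. Each generator updates the label of a single
  column.\<close>

definition cut_top :: "nat \<Rightarrow> nat \<Rightarrow> vertex set set" where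
  "cut_top n i = fibres n (rows Some (Some(i := None)))"

definition dot_top :: "nat \<Rightarrow> nat \<Rightarrow> vertex set set" where
  "dot_top n i = fibres n (rows (Some(i := None)) Some)"

definition merge :: "nat \<Rightarrow> nat \<Rightarrow> nat \<Rightarrow> vertex set set" where
  "merge n i j = fibres n (rows (Some(j := Some i)) (Some(j := Some i)))"

definition identity :: "nat \<Rightarrow> vertex set set" where
  "identity n = fibres n (rows Some Some)"

text \<open>The usual candidate for \<open>h\<close> in \<open>rook_mult_fibres\<close>: the bottom
  row of the left factor becomes the middle row, and \<open>b\<close> is the new bottom row.\<close>

fun stack :: "(vertex \<Rightarrow> 'l option) \<Rightarrow> (nat \<Rightarrow> 'l option) \<Rightarrow> vertex \<Rightarrow> 'l option" where
  "stack f b (Unprimed k) = f (Unprimed k)"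
| "stack f b (DPrimed k) = f (Primed k)"
| "stack f b (Primed k) = b k"

lemma stack_primed_to_middle:
  "x \<in> boundary n \<Longrightarrow> stack f b (primed_to_middle x) = f x"
  by (auto elim!: boundaryE)

lemma fibres_stack: "fibres n (stack f b) = fibres n (rows (\<lambda>k. f (Unprimed k)) b)"
  by (rule fibres_cong) (auto elim!: boundaryE)

lemma white_leftI:
  "x \<in> boundary n \<Longrightarrow> f x = None \<Longrightarrow> primed_to_middle x \<in> white_vertices n (fibres n f) \<beta>"
  by (auto simp: white_vertices_def rook_dots_fibres)

lemma white_rightI:
  "x \<in> boundary n \<Longrightarrow> f x = None \<Longrightarrow> unprimed_to_middle x \<in> white_vertices n \<alpha> (fibres n f)"
  by (auto simp: white_vertices_def rook_dots_fibres)

text \<open>For a top point the path is empty, since \<open>primed_to_middle\<close> fixes it. At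
  \<open>Primed k\<close> the right factor has \<open>k\<close> and \<open>k'\<close> in one block,
  which is a direct edge.\<close>

lemma product_graph_descend:
  assumes "x \<in> boundary n" "\<And>k. x = Primed k \<Longrightarrow> a k = b k \<and> a k \<noteq> None"
  shows "(x, primed_to_middle x) \<in> (product_graph \<alpha> (fibres n (rows a b)))\<^sup>*"
    and "(primed_to_middle x, x) \<in> (product_graph \<alpha> (fibres n (rows a b)))\<^sup>*"
proof -
  have "(Primed k, DPrimed k) \<in> product_graph \<alpha> (fibres n (rows a b))"
    "(DPrimed k, Primed k) \<in> product_graph \<alpha> (fibres n (rows a b))" if x: "x = Primed k" for k
  proof -
    have k: "Primed k \<in> boundary n" "Unprimed k \<in> boundary n"
      using assms(1) x by simp_all
    have "rows a b (Primed k) = rows a b (Unprimed k)" "rows a b (Unprimed k) = rows a b (Primed k)"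
      "rows a b (Unprimed k) \<noteq> None" "rows a b (Primed k) \<noteq> None"
      using assms(2)[OF x] by (metis rows.simps(1,2))+
    then show "(Primed k, DPrimed k) \<in> product_graph \<alpha> (fibres n (rows a b))"
      "(DPrimed k, Primed k) \<in> product_graph \<alpha> (fibres n (rows a b))"
      using product_graph_rightI[OF k, of "rows a b" \<alpha>]
        product_graph_rightI[OF k(2,1), of "rows a b" \<alpha>]
      by (simp_all only: unprimed_to_middle.simps)
  qed
  then show "(x, primed_to_middle x) \<in> (product_graph \<alpha> (fibres n (rows a b)))\<^sup>*"
    and "(primed_to_middle x, x) \<in> (product_graph \<alpha> (fibres n (rows a b)))\<^sup>*"
    using assms(1) by (auto elim!: boundaryE)
qed

text \<open>The path enters the middle row through a vertical edge if \<open>x\<close> is a bottom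
  point, follows one block of the left factor, and leaves in the same way towards
  \<open>y\<close>.\<close>

lemma product_graph_connected:
  assumes "x \<in> boundary n" "\<And>k. x = Primed k \<Longrightarrow> a k = b k \<and> a k \<noteq> None"
    and "y \<in> boundary n" "\<And>k. y = Primed k \<Longrightarrow> a k = b k \<and> a k \<noteq> None"
    and "f x = f y" "f x \<noteq> None"
  shows "(x, y) \<in> (product_graph (fibres n f) (fibres n (rows a b)))\<^sup>*"
  using product_graph_descend(1)[OF assms(1,2), where \<alpha> = "fibres n f"]
    product_graph_leftI[OF assms(1,3,5,6), of "fibres n (rows a b)"]
    product_graph_descend(2)[OF assms(3,4), where \<alpha> = "fibres n f"]
  by (meson rtrancl.rtrancl_into_rtrancl rtrancl_trans)

text \<open>The left factor consists of vertical edges, so each middle vertex takes the label that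
  the right factor gives to its top point.\<close>

lemma identity_mult:
  assumes "\<beta> \<in> rook_partitions n"
  shows "rook_mult n (identity n) \<beta> = \<beta>"
proof -
  obtain g :: "vertex \<Rightarrow> vertex set option" where g: "\<beta> = fibres n g"
    by (rule rook_partition_as_fibres[OF assms])
  define h where "h x = (case x of DPrimed k \<Rightarrow> g (Unprimed k) | _ \<Rightarrow> g x)" for x
  have h_um: "h (unprimed_to_middle x) = g x" if "x \<in> boundary n" for x
    using that by (auto elim!: boundaryE simp: h_def)
  have h_bd: "h x = g x" if "x \<in> boundary n" for x
    using that by (auto elim!: boundaryE simp: h_def)
  let ?G = "product_graph (fibres n (rows Some Some)) (fibres n g)"
  have down: "(x, unprimed_to_middle x) \<in> ?G\<^sup>*" "(unprimed_to_middle x, x) \<in> ?G\<^sup>*"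
    if "x \<in> boundary n" for x
    using that product_graph_leftI[of "Unprimed k" n "Primed k" "rows Some Some" "fibres n g" for k]
      product_graph_leftI[of "Primed k" n "Unprimed k" "rows Some Some" "fibres n g" for k]
    by (auto elim!: boundaryE)
  have "rook_mult n (fibres n (rows Some Some)) (fibres n g) = fibres n h"
  proof (rule rook_mult_fibres)
    fix x y assume "x \<in> boundary n" "y \<in> boundary n" "h x = h y" "h x \<noteq> None"
    then show "(x, y) \<in> ?G\<^sup>*"
      using down product_graph_rightI[of x n y g] h_bd
      by (metis (no_types, lifting) rtrancl.rtrancl_into_rtrancl rtrancl_trans)
  next
    fix x assume "x \<in> boundary n" "h x = None"
    then show "\<exists>w\<in>white_vertices n (fibres n (rows Some Some)) (fibres n g). (x, w) \<in> ?G\<^sup>*"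
      using down white_rightI h_bd by metis
  qed (auto simp: h_um elim!: boundaryE, auto simp: h_def)
  also have "\<dots> = fibres n g"
    by (rule fibres_cong) (simp_all add: h_bd)
  finally show ?thesis by (simp add: identity_def g)
qed

text \<open>In column \<open>i\<close> the right factor has the block \<open>{i}\<close>, which
  changes nothing in the left factor, and a rook dot at \<open>i'\<close>, which is the new bottom
  point.\<close>

lemma mult_cut_top:
  assumes i: "i \<in> {1..n}"
  shows "rook_mult n (fibres n f) (cut_top n i) = fibres n (f(Primed i := None))"
proof -
  let ?a = "Some :: nat \<Rightarrow> nat option" and ?b = "Some(i := None) :: nat \<Rightarrow> nat option"
  define h where "h = stack f (\<lambda>k. if k = i then None else f (Primed k))"
  have "rook_mult n (fibres n f) (fibres n (rows ?a ?b)) = fibres n h"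
  proof (rule rook_mult_fibres)
    fix x y assume xy: "x \<in> boundary n" "y \<in> boundary n" "h x = h y" "h x \<noteq> None"
    then have "x \<noteq> Primed i" "y \<noteq> Primed i" "f x = f y" "f x \<noteq> None"
      by (auto simp: h_def elim!: boundaryE split: if_splits)
    with xy show "(x, y) \<in> (product_graph (fibres n f) (fibres n (rows ?a ?b)))\<^sup>*"
      by (intro product_graph_connected) auto
  next
    fix x assume x: "x \<in> boundary n" "h x = None"
    show "\<exists>w\<in>white_vertices n (fibres n f) (fibres n (rows ?a ?b)).
      (x, w) \<in> (product_graph (fibres n f) (fibres n (rows ?a ?b)))\<^sup>*"
    proof (cases "x = Primed i")
      case True
      then show ?thesis using white_rightI[of x n "rows ?a ?b" "fibres n f"] x by auto
    next
      case False
      then have "f x = None" using x by (auto simp: h_def elim!: boundaryE split: if_splits)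
      then show ?thesis
        using x(1) False white_leftI product_graph_descend(1)[of x n ?a ?b "fibres n f"]
        by (metis fun_upd_other option.distinct(1))
    qed
  qed (auto simp: h_def stack_primed_to_middle elim!: boundaryE split: if_splits)
  moreover have "fibres n h = fibres n (f(Primed i := None))"
    unfolding h_def fibres_stack by (rule fibres_cong) (auto elim!: boundaryE)
  ultimately show ?thesis by (simp add: cut_top_def)
qed

lemma mult_dot_top:
  assumes i: "i \<in> {1..n}"
    and s: "\<And>x. x \<in> boundary n \<Longrightarrow> f x = Some s \<Longrightarrow> f x = f (Primed i)"
  shows "rook_mult n (fibres n f) (dot_top n i)
    = fibres n ((\<lambda>x. if f x = f (Primed i) then None else f x)(Primed i := Some s))"
proof -
  let ?a = "Some(i := None) :: nat \<Rightarrow> nat option" and ?b = "Some :: nat \<Rightarrow> nat option"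
  define F where "F x = (if f x = f (Primed i) then None else f x)" for x
  define h where "h = stack F (\<lambda>k. if k = i then Some s else F (Primed k))"
  \<comment> \<open>After the kill no point carries \<open>s\<close>, so the new block consists of
    \<open>Primed i\<close> alone.\<close>
  have Fs: "F x \<noteq> Some s" if "x \<in> boundary n" for x
    using s[OF that] by (auto simp: F_def)
  have "rook_mult n (fibres n f) (fibres n (rows ?a ?b)) = fibres n h"
  proof (rule rook_mult_fibres)
    fix x y assume xy: "x \<in> boundary n" "y \<in> boundary n" "h x = h y" "h x \<noteq> None"
    have hF: "h z = (if z = Primed i then Some s else F z)" if "z \<in> boundary n" for z
      using that by (auto simp: h_def elim!: boundaryE split: if_splits)
    show "(x, y) \<in> (product_graph (fibres n f) (fibres n (rows ?a ?b)))\<^sup>*"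
    proof (cases "x = Primed i \<or> y = Primed i")
      case True
      then have "x = y" using xy hF Fs by (metis (full_types))
      then show ?thesis by simp
    next
      case False
      then have "f x = f y" "f x \<noteq> None"
        using xy hF by (auto simp: F_def split: if_splits)
      with xy False show ?thesis by (intro product_graph_connected) auto
    qed
  next
    fix x assume x: "x \<in> boundary n" "h x = None"
    then have xi: "x \<noteq> Primed i" and Fx: "F x = None"
      by (auto simp: h_def elim!: boundaryE split: if_splits)
    have down: "(x, primed_to_middle x) \<in> (product_graph (fibres n f) (fibres n (rows ?a ?b)))\<^sup>*"
      using x(1) xi by (intro product_graph_descend(1)) auto
    show "\<exists>w\<in>white_vertices n (fibres n f) (fibres n (rows ?a ?b)).
      (x, w) \<in> (product_graph (fibres n f) (fibres n (rows ?a ?b)))\<^sup>*"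
    proof (cases "f x = None")
      case True
      then show ?thesis using x(1) down white_leftI by metis
    next
      case False
      then have "f x = f (Primed i)" using Fx by (auto simp: F_def split: if_splits)
      then have "(primed_to_middle x, DPrimed i) \<in> product_graph (fibres n f) (fibres n (rows ?a ?b))"
        using product_graph_leftI[of x n "Primed i" f] x(1) i False by simp
      moreover have "DPrimed i \<in> white_vertices n (fibres n f) (fibres n (rows ?a ?b))"
        using white_rightI[of "Unprimed i" n "rows ?a ?b" "fibres n f"] i by simp
      ultimately show ?thesis using down by (meson rtrancl.rtrancl_into_rtrancl)
    qed
  qed (auto simp: h_def F_def stack_primed_to_middle elim!: boundaryE split: if_splits)
  moreover have "fibres n h = fibres n (F(Primed i := Some s))"
    unfolding h_def fibres_stack by (rule fibres_cong) (auto elim!: boundaryE)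
  ultimately show ?thesis by (simp add: dot_top_def F_def[abs_def])
qed

text \<open>The right factor joins the middle vertices of columns \<open>i\<close> and
  \<open>j\<close>. The condition \<open>nz\<close> excludes a dot at \<open>j\<close> facing a
  label at \<open>i\<close>: there the dot would absorb the label, whereas the formula would turn
  all dots into labelled points.\<close>

lemma mult_merge:
  assumes ij: "i \<in> {1..n}" "j \<in> {1..n}" and nz: "f (Primed j) \<noteq> None \<or> f (Primed i) = None"
  shows "rook_mult n (fibres n f) (merge n i j)
    = fibres n (\<lambda>x. if f x = f (Primed j) then f (Primed i) else f x)"
proof -
  let ?a = "Some(j := Some i) :: nat \<Rightarrow> nat option"
  let ?G = "product_graph (fibres n f) (fibres n (rows ?a ?a))"
  define F where "F x = (if f x = f (Primed j) then f (Primed i) else f x)" for x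
  define h where "h = stack F (\<lambda>k. F (Primed k))"
  have hF: "h z = F z" if "z \<in> boundary n" for z
    using that by (auto simp: h_def elim!: boundaryE)
  have down: "(z, primed_to_middle z) \<in> ?G\<^sup>*" "(primed_to_middle z, z) \<in> ?G\<^sup>*"
    if "z \<in> boundary n" for z
    using that by (intro product_graph_descend; auto)+
  have bridge: "(DPrimed j, DPrimed i) \<in> ?G" "(DPrimed i, DPrimed j) \<in> ?G"
    using product_graph_rightI[of "Unprimed j" n "Unprimed i" "rows ?a ?a" "fibres n f"]
      product_graph_rightI[of "Unprimed i" n "Unprimed j" "rows ?a ?a" "fibres n f"] ij by simp_all
  have same: "(x, y) \<in> ?G\<^sup>*" if "x \<in> boundary n" "y \<in> boundary n" "f x = f y" "f x \<noteq> None" for x y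
    using that by (intro product_graph_connected) auto
  have toj: "(Primed j, Primed i) \<in> ?G\<^sup>*" "(Primed i, Primed j) \<in> ?G\<^sup>*"
    using down[of "Primed i"] down[of "Primed j"] bridge ij
    by (auto intro: rtrancl_trans rtrancl.rtrancl_into_rtrancl)
  \<comment> \<open>Each point is joined to one whose old label equals its new label:
    \<open>Primed i\<close> if its block is the one redirected, and the point itself
    otherwise.\<close>
  have rep: "\<exists>z. z \<in> boundary n \<and> f z = F x \<and> (x, z) \<in> ?G\<^sup>* \<and> (z, x) \<in> ?G\<^sup>*"
    if "x \<in> boundary n" for x
  proof (cases "f x = f (Primed j) \<and> f x \<noteq> None")
    case True
    then have "(x, Primed i) \<in> ?G\<^sup>*" "(Primed i, x) \<in> ?G\<^sup>*"
      using same[of x "Primed j"] same[of "Primed j" x] that ij toj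
      by (metis in_boundary(2) atLeastAtMost_iff rtrancl_trans)+
    then show ?thesis using True ij by (intro exI[of _ "Primed i"]) (auto simp: F_def)
  next
    case False
    then show ?thesis using that nz by (intro exI[of _ x]) (auto simp: F_def)
  qed
  have "rook_mult n (fibres n f) (fibres n (rows ?a ?a)) = fibres n h"
  proof (rule rook_mult_fibres)
    fix x y assume xy: "x \<in> boundary n" "y \<in> boundary n" "h x = h y" "h x \<noteq> None"
    obtain u v where "u \<in> boundary n" "f u = F x" "(x, u) \<in> ?G\<^sup>*"
      "v \<in> boundary n" "f v = F y" "(v, y) \<in> ?G\<^sup>*"
      using rep[OF xy(1)] rep[OF xy(2)] by blast
    with xy same[of u v] hF show "(x, y) \<in> ?G\<^sup>*" by (metis rtrancl_trans)
  next
    fix x assume x: "x \<in> boundary n" "h x = None"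
    then obtain u where u: "u \<in> boundary n" "f u = None" "(x, u) \<in> ?G\<^sup>*"
      using rep hF by metis
    then show "\<exists>w\<in>white_vertices n (fibres n f) (fibres n (rows ?a ?a)). (x, w) \<in> ?G\<^sup>*"
      using down(1)[OF u(1)] white_leftI[of u n f] by (meson rtrancl_trans)
  qed (use nz in \<open>auto simp: h_def F_def stack_primed_to_middle elim!: boundaryE split: if_splits\<close>)
  moreover have "fibres n h = fibres n F"
    by (rule fibres_cong) (simp_all add: hF)
  ultimately show ?thesis by (simp add: merge_def F_def[abs_def])
qed

section \<open>Indexing and idempotency of the generators\<close>

text \<open>One range holds three families: the diagonal for \<open>cut_top\<close>, the value
  \<open>0\<close> for \<open>dot_top\<close>, and the pairs strictly between for
  \<open>merge\<close>.\<close>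

definition index_set :: "nat \<Rightarrow> (nat \<times> nat) set" where
  "index_set n = (SIGMA j:{1..n}. {0..j})"

lemma card_index_set: "card (index_set n) = (n\<^sup>2 + 3 * n) div 2"
proof -
  have "card (index_set n) = (\<Sum>j = 1..n. Suc j)"
    by (simp add: index_set_def)
  moreover have "2 * (\<Sum>j = 1..n. Suc j) = n\<^sup>2 + 3 * n"
    by (induction n) (auto simp: power2_eq_square algebra_simps)
  ultimately show ?thesis by simp
qed

fun generator :: "nat \<Rightarrow> nat \<times> nat \<Rightarrow> vertex set set" where
  "generator n (j, i) = (if i = j then cut_top n j else if i = 0 then dot_top n j else merge n i j)"

lemma generator_in_rook_partitions: "generator n q \<in> rook_partitions n"
  by (cases q) (simp add: cut_top_def dot_top_def merge_def fibres_in_rook_partitions)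

text \<open>The action of a generator on labellings leaves the labelling of that generator itself
  unchanged, up to renaming.\<close>

lemma generator_idempotent:
  assumes "q \<in> index_set n"
  shows "rook_mult n (generator n q) (generator n q) = generator n q"
proof -
  obtain j i where q: "q = (j, i)" by fastforce
  have j: "j \<in> {1..n}" and i: "i \<le> j" using assms by (auto simp: q index_set_def)
  have "rook_mult n (cut_top n j) (cut_top n j) = cut_top n j"
  proof -
    have "rook_mult n (cut_top n j) (cut_top n j)
        = fibres n ((rows Some (Some(j := None)))(Primed j := None))"
      using mult_cut_top[OF j, of "rows Some (Some(j := None))"] by (simp add: cut_top_def)
    also have "\<dots> = cut_top n j"
      unfolding cut_top_def by (rule fibres_cong) (auto elim!: boundaryE)
    finally show ?thesis .
  qed
  moreover have "rook_mult n (dot_top n j) (dot_top n j) = dot_top n j"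
  proof -
    let ?f = "rows (Some(j := None)) Some"
    \<comment> \<open>The label \<open>j\<close> occurs only at \<open>Primed j\<close>; it is
      killed there and then put back.\<close>
    have "rook_mult n (dot_top n j) (dot_top n j)
        = fibres n ((\<lambda>x. if ?f x = ?f (Primed j) then None else ?f x)(Primed j := Some j))"
      using mult_dot_top[OF j, of ?f j] by (simp add: dot_top_def)
    also have "(\<lambda>x. if ?f x = ?f (Primed j) then None else ?f x)(Primed j := Some j) = ?f"
    proof
      fix x show "((\<lambda>x. if ?f x = ?f (Primed j) then None else ?f x)(Primed j := Some j)) x = ?f x"
        by (cases x) auto
    qed
    finally show ?thesis by (simp add: dot_top_def)
  qed
  moreover have "rook_mult n (merge n i j) (merge n i j) = merge n i j" if "i \<noteq> 0"
  proof -
    let ?f = "rows (Some(j := Some i)) (Some(j := Some i))"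
    have "i \<in> {1..n}" using that i j by simp
    then have "rook_mult n (merge n i j) (merge n i j)
        = fibres n (\<lambda>x. if ?f x = ?f (Primed j) then ?f (Primed i) else ?f x)"
      using mult_merge[OF _ j, of i ?f] by (simp add: merge_def)
    also have "\<dots> = fibres n ?f" by (rule fibres_cong) auto
    finally show ?thesis by (simp add: merge_def)
  qed
  ultimately show ?thesis by (simp add: q)
qed

section \<open>Defects of the top row\<close>

text \<open>An index \<open>(j, i)\<close> with \<open>i < j\<close> says that \<open>j\<close> and \<open>i\<close> are identified, where the index
  \<open>0\<close> stands for a point to which all rook dots are attached; the index \<open>(j, j)\<close> says that the
  block of \<open>j\<close> is not transversal.\<close>

definition defects :: "nat \<Rightarrow> vertex set set \<Rightarrow> (nat \<times> nat) set" where
  "defects n \<alpha> = {(j, i) \<in> index_set n.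
     if i = j then \<exists>B\<in>\<alpha>. Unprimed j \<in> B \<and> B \<subseteq> top_row n
     else if i = 0 then Unprimed j \<notin> \<Union>\<alpha>
     else \<forall>B\<in>\<alpha>. Unprimed i \<in> B \<longleftrightarrow> Unprimed j \<in> B}"

lemma in_fibre_iff:
  assumes "x \<in> boundary n"
  shows "B \<in> fibres n f \<and> x \<in> B \<longleftrightarrow> f x \<noteq> None \<and> B = {y \<in> boundary n. f y = f x}"
  using assms unfolding fibres_def by auto

text \<open>Two top points lie in the same blocks exactly when their labels agree; this includes two
  rook dots, which both have the label \<open>None\<close>.\<close>

lemma defects_fibres:
  "(j, i) \<in> defects n (fibres n f) \<longleftrightarrow> (j, i) \<in> index_set n \<and>
     (if i = j then f (Unprimed j) \<noteq> None \<and> (\<forall>m\<in>{1..n}. f (Primed m) \<noteq> f (Unprimed j))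
      else if i = 0 then f (Unprimed j) = None
      else f (Unprimed i) = f (Unprimed j))"
proof (cases "(j, i) \<in> index_set n")
  case True
  then have j: "Unprimed j \<in> boundary n" and i: "i \<noteq> 0 \<Longrightarrow> Unprimed i \<in> boundary n"
    by (auto simp: index_set_def)
  have top: "{y \<in> boundary n. f y = f (Unprimed j)} \<subseteq> top_row n \<longleftrightarrow>
      (\<forall>m\<in>{1..n}. f (Primed m) \<noteq> f (Unprimed j))"
  proof
    assume *: "{y \<in> boundary n. f y = f (Unprimed j)} \<subseteq> top_row n"
    have "Primed m \<notin> top_row n" for m by (auto simp: top_row_def)
    moreover have "f (Primed m) = f (Unprimed j) \<Longrightarrow> m \<in> {1..n} \<Longrightarrow> Primed m \<in> top_row n" for m
      using * by (intro subsetD[OF *]) simp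
    ultimately show "\<forall>m\<in>{1..n}. f (Primed m) \<noteq> f (Unprimed j)" by blast
  qed (auto simp: top_row_def elim!: boundaryE)
  have "(\<exists>B\<in>fibres n f. Unprimed j \<in> B \<and> B \<subseteq> top_row n) \<longleftrightarrow>
      f (Unprimed j) \<noteq> None \<and> (\<forall>m\<in>{1..n}. f (Primed m) \<noteq> f (Unprimed j))"
    using in_fibre_iff[OF j, of _ f] top by metis
  moreover have "Unprimed j \<notin> \<Union>(fibres n f) \<longleftrightarrow> f (Unprimed j) = None"
    using in_fibre_iff[OF j, of _ f] by blast
  moreover have "(\<forall>B\<in>fibres n f. Unprimed i \<in> B \<longleftrightarrow> Unprimed j \<in> B) \<longleftrightarrow> f (Unprimed i) = f (Unprimed j)"
    if "i \<noteq> 0"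
  proof
    assume "f (Unprimed i) = f (Unprimed j)"
    then show "\<forall>B\<in>fibres n f. Unprimed i \<in> B \<longleftrightarrow> Unprimed j \<in> B"
      using in_fibre_iff[OF j, of _ f] in_fibre_iff[OF i[OF that], of _ f] by metis
  next
    assume *: "\<forall>B\<in>fibres n f. Unprimed i \<in> B \<longleftrightarrow> Unprimed j \<in> B"
    let ?F = "\<lambda>x. {y \<in> boundary n. f y = f x}"
    have "f (Unprimed j) \<noteq> None \<Longrightarrow> Unprimed i \<in> ?F (Unprimed j)"
      using in_fibre_iff[OF j, of _ f] * by metis
    moreover have "f (Unprimed i) \<noteq> None \<Longrightarrow> Unprimed j \<in> ?F (Unprimed i)"
      using in_fibre_iff[OF i[OF that], of _ f] * by metis
    ultimately show "f (Unprimed i) = f (Unprimed j)" by force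
  qed
  ultimately show ?thesis using True unfolding defects_def by simp
qed (simp add: defects_def)

text \<open>The defects occur independently of each other. This makes the generators distinct, and
  in the lower bound it isolates one defect at a time.\<close>

lemma defects_generator:
  assumes "q \<in> index_set n"
  shows "defects n (generator n q) = {q}"
proof -
  obtain j i where q: "q = (j, i)" by fastforce
  have "(k, m) \<in> defects n (generator n (j, i)) \<longleftrightarrow> k = j \<and> m = i" for k m
    using assms by (auto simp: q cut_top_def dot_top_def merge_def defects_fibres index_set_def
        split: if_splits)
  then show ?thesis by (auto simp: q)
qed

section \<open>Units as the rook partitions without defects\<close>

definition shared_labels :: "nat \<Rightarrow> (vertex \<Rightarrow> 'l option) \<Rightarrow> 'l option set" where
  "shared_labels n f = {v. v \<noteq> None \<and> (\<exists>k\<in>{1..n}. f (Unprimed k) = v) \<and> (\<exists>m\<in>{1..n}. f (Primed m) = v)}"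

text \<open>Sending a label to its fibre is a bijection from the shared labels onto the transversal
  blocks.\<close>

lemma card_transversal_blocks_fibres:
  "card (transversal_blocks n (fibres n f)) = card (shared_labels n f)"
proof -
  let ?F = "\<lambda>v. {y \<in> boundary n. f y = v}"
  have "inj_on ?F (shared_labels n f)"
  proof
    fix v w assume "v \<in> shared_labels n f" "w \<in> shared_labels n f" and eq: "?F v = ?F w"
    then obtain k where "k \<in> {1..n}" "f (Unprimed k) = v" by (auto simp: shared_labels_def)
    then have "Unprimed k \<in> ?F v" by simp
    then show "v = w" using eq \<open>f (Unprimed k) = v\<close> by auto
  qed
  moreover have "?F ` shared_labels n f = transversal_blocks n (fibres n f)"
  proof (intro equalityI subsetI)
    fix B assume "B \<in> ?F ` shared_labels n f"
    then obtain k m where k: "k \<in> {1..n}" "m \<in> {1..n}" "f (Unprimed k) \<noteq> None"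
      "f (Primed m) = f (Unprimed k)" "B = ?F (f (Unprimed k))"
      by (auto simp: shared_labels_def)
    then have "B \<in> fibres n f" unfolding fibres_def by (intro CollectI exI[of _ "Unprimed k"]) simp
    moreover have "Unprimed k \<in> B \<inter> top_row n" "Primed m \<in> B \<inter> bottom_row n"
      using k by (auto simp: top_row_def bottom_row_def)
    ultimately show "B \<in> transversal_blocks n (fibres n f)" unfolding transversal_blocks_def by blast
  next
    fix B assume "B \<in> transversal_blocks n (fibres n f)"
    then obtain k m where "B \<in> fibres n f" "k \<in> {1..n}" "Unprimed k \<in> B" "m \<in> {1..n}" "Primed m \<in> B"
      unfolding transversal_blocks_def top_row_def bottom_row_def by blast
    moreover from this have "f (Unprimed k) \<noteq> None" "B = ?F (f (Unprimed k))"
      using in_fibre_iff[of "Unprimed k" n B f] by auto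
    moreover from calculation have "f (Primed m) = f (Unprimed k)" by blast
    ultimately have "f (Unprimed k) \<in> shared_labels n f" unfolding shared_labels_def by blast
    then show "B \<in> ?F ` shared_labels n f" using \<open>B = ?F (f (Unprimed k))\<close> by blast
  qed
  ultimately show ?thesis using card_image[of ?F "shared_labels n f"] by simp
qed

lemma shared_labels_subset: "shared_labels n f \<subseteq> (\<lambda>k. f (Unprimed k)) ` {1..n}"
proof
  fix v assume "v \<in> shared_labels n f"
  then obtain k where "k \<in> {1..n}" "v = f (Unprimed k)" by (auto simp: shared_labels_def)
  then show "v \<in> (\<lambda>k. f (Unprimed k)) ` {1..n}" by blast
qed

lemma finite_shared_labels: "finite (shared_labels n f)"
  using shared_labels_subset finite_surj by (metis finite_atLeastAtMost)

lemma card_shared_labels_le: "card (shared_labels n f) \<le> n"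
  using surj_card_le[OF _ shared_labels_subset[of n f]] by simp

lemma fibres_unit_iff: "fibres n f \<in> rook_units n \<longleftrightarrow> card (shared_labels n f) = n"
  by (simp add: rook_units_def fibres_in_rook_partitions card_transversal_blocks_fibres)

text \<open>Having \<open>n\<close> transversal blocks on \<open>n\<close> top points means that the
  top labels are not \<open>None\<close>, pairwise distinct, and all present in the bottom row. The
  three kinds of defect are the failures of these three properties.\<close>

lemma unit_iff_no_defects:
  assumes "\<alpha> \<in> rook_partitions n"
  shows "\<alpha> \<in> rook_units n \<longleftrightarrow> defects n \<alpha> = {}"
proof -
  obtain f :: "vertex \<Rightarrow> vertex set option" where \<alpha>: "\<alpha> = fibres n f"
    by (rule rook_partition_as_fibres[OF assms])
  let ?t = "\<lambda>k. f (Unprimed k)"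
  show ?thesis
  proof
    assume "\<alpha> \<in> rook_units n"
    then have c: "card (shared_labels n f) = n" by (simp add: \<alpha> fibres_unit_iff)
    have le: "card (?t ` {1..n}) \<le> n" using card_image_le[of "{1..n}" ?t] by simp
    \<comment> \<open>The top row has at most \<open>n\<close> labels, so \<open>n\<close> shared
      ones exhaust it and no label repeats.\<close>
    then have eq: "shared_labels n f = ?t ` {1..n}"
      using card_seteq[OF _ shared_labels_subset[of n f]] c by simp
    then have inj: "inj_on ?t {1..n}" using c by (intro eq_card_imp_inj_on) auto
    have sh: "?t k \<noteq> None \<and> (\<exists>m\<in>{1..n}. f (Primed m) = ?t k)" if "k \<in> {1..n}" for k
    proof -
      have "?t k \<in> shared_labels n f" using that eq by blast
      then show ?thesis by (auto simp: shared_labels_def)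
    qed
    have "(j, i) \<notin> defects n \<alpha>" for j i
    proof
      assume "(j, i) \<in> defects n \<alpha>"
      then have d: "j \<in> {1..n}" "i \<le> j" "if i = j then \<forall>m\<in>{1..n}. f (Primed m) \<noteq> f (Unprimed j)
          else if i = 0 then f (Unprimed j) = None else f (Unprimed i) = f (Unprimed j)"
        by (auto simp: \<alpha> defects_fibres index_set_def split: if_splits)
      show False
      proof (cases "i = j \<or> i = 0")
        case True
        then show False using d sh[of j] by (auto split: if_splits)
      next
        case False
        then have "?t i = ?t j" "i \<in> {1..n}" "i \<noteq> j" using d by auto
        then show False using inj d(1) by (auto dest: inj_onD)
      qed
    qed
    then show "defects n \<alpha> = {}" by auto
  next
    assume "defects n \<alpha> = {}"
    then have no: "(j, i) \<notin> defects n (fibres n f)" for j i by (simp add: \<alpha>)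
    have some: "?t k \<noteq> None" if "k \<in> {1..n}" for k
      using no[of k 0] that by (auto simp: defects_fibres index_set_def)
    have ne: "?t k \<noteq> ?t m" if "k \<in> {1..n}" "m \<in> {1..n}" "k < m" for k m
      using no[of m k] that by (auto simp: defects_fibres index_set_def)
    have "inj_on ?t {1..n}"
      by (rule linorder_inj_onI) (use ne in auto)
    then have "card (?t ` {1..n}) = n" by (simp add: card_image)
    moreover have "?t ` {1..n} \<subseteq> shared_labels n f"
    proof
      fix v assume "v \<in> ?t ` {1..n}"
      then obtain k where k: "k \<in> {1..n}" "v = ?t k" by blast
      then have "\<exists>m\<in>{1..n}. f (Primed m) = ?t k"
        using no[of k k] some[of k] by (auto simp: defects_fibres index_set_def)
      then show "v \<in> shared_labels n f" using k some[of k] by (auto simp: shared_labels_def)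
    qed
    ultimately show "\<alpha> \<in> rook_units n"
      using shared_labels_subset[of n f] by (simp add: \<alpha> fibres_unit_iff subset_antisym)
  qed
qed

section \<open>Inheritance of defects\<close>

text \<open>Top vertices meet only the left factor. Hence its top dots stay white, its blocks inside
  the top row are whole components of the product graph, and top points that it joins remain
  joined.\<close>

lemma defects_mult:
  assumes "\<alpha> \<in> rook_partitions n"
  shows "defects n \<alpha> \<subseteq> defects n (rook_mult n \<alpha> \<beta>)"
proof
  fix q assume q: "q \<in> defects n \<alpha>"
  obtain j i where ji: "q = (j, i)" by fastforce
  let ?G = "product_graph \<alpha> \<beta>" and ?D = "product_dots n \<alpha> \<beta>" and ?P = "rook_mult n \<alpha> \<beta>"
  have idx: "(j, i) \<in> index_set n" using q by (simp add: ji defects_def)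
  then have jb: "Unprimed j \<in> boundary n" and ib: "i \<noteq> 0 \<Longrightarrow> Unprimed i \<in> boundary n"
    by (auto simp: index_set_def)
  have dot: "x \<notin> \<Union>?P" if "Unprimed k \<in> boundary n" "Unprimed k \<notin> \<Union>\<alpha>" "x = Unprimed k" for k x
  proof -
    have "primed_to_middle (Unprimed k) \<in> white_vertices n \<alpha> \<beta>"
      unfolding white_vertices_def rook_dots_def using that by blast
    then have "x \<in> ?D" using that unfolding product_dots_def by auto
    then show ?thesis unfolding rook_dots_rook_mult[symmetric] rook_dots_def by blast
  qed
  have s: "(y, x) \<in> ?G\<^sup>*" if "(x, y) \<in> ?G\<^sup>*" for x y
    using that sym_product_graph sym_rtrancl symD by metis
  consider "i = j" | "i \<noteq> j" "i = 0" | "i \<noteq> j" "i \<noteq> 0" by blast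
  then have "if i = j then \<exists>B\<in>?P. Unprimed j \<in> B \<and> B \<subseteq> top_row n
     else if i = 0 then Unprimed j \<notin> \<Union>?P
     else \<forall>B\<in>?P. Unprimed i \<in> B \<longleftrightarrow> Unprimed j \<in> B"
  proof cases
    case 1
    then obtain B where B: "B \<in> \<alpha>" "Unprimed j \<in> B" "B \<subseteq> top_row n"
      using q by (auto simp: ji defects_def)
    \<comment> \<open>No vertex of the right factor is relabelled to a top vertex, so the edge comes
      from a block of \<alpha>; by disjointness that block is \<open>B\<close>, whose points
      relabelling fixes.\<close>
    have edge: "z \<in> B" if y: "y \<in> B" and yz: "(y, z) \<in> ?G" for y z
    proof -
      obtain k where k: "y = Unprimed k" using y B(3) by (auto simp: top_row_def)
      have um: "y \<noteq> unprimed_to_middle u" for u by (cases u) (auto simp: k)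
      have pm: "u = y" if "y = primed_to_middle u" for u using that by (cases u) (auto simp: k)
      obtain C where C: "C \<in> \<alpha>" "y \<in> primed_to_middle ` C" "z \<in> primed_to_middle ` C"
        using yz um unfolding product_graph_def by blast
      have "y \<in> C" using C(2) pm by (metis imageE)
      then have "C = B"
        using assms B(1) C(1) y by (auto simp: rook_partitions_def pairwise_def disjnt_def)
      then show ?thesis using C(3) B(3) by (auto simp: top_row_def)
    qed
    have comp: "y \<in> B" if "(Unprimed j, y) \<in> ?G\<^sup>*" for y
      using that by induction (use B edge in auto)
    have "w \<notin> B" if "w \<in> white_vertices n \<alpha> \<beta>" for w
    proof
      assume w: "w \<in> B"
      obtain k where k: "w = Unprimed k" using w B(3) by (auto simp: top_row_def)
      have um: "w \<noteq> unprimed_to_middle u" for u by (cases u) (auto simp: k)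
      have pm: "u = w" if "w = primed_to_middle u" for u using that by (cases u) (auto simp: k)
      have "w \<in> rook_dots n \<alpha>" using that um pm unfolding white_vertices_def by (metis UnE imageE)
      then show False using w B(1) by (auto simp: rook_dots_def)
    qed
    then have black: "Unprimed j \<notin> ?D" using comp unfolding product_dots_def by auto
    let ?B = "{y \<in> boundary n - ?D. (Unprimed j, y) \<in> ?G\<^sup>*}"
    have mem: "?B \<in> ?P" unfolding rook_mult_def using jb black by blast
    have j: "Unprimed j \<in> ?B" using jb black by blast
    have sub: "?B \<subseteq> top_row n" using comp B(3) by blast
    show ?thesis unfolding if_P[OF 1] by (rule bexI[where x = ?B]) (intro conjI j sub mem)+
  next
    case 2
    then have "Unprimed j \<notin> \<Union>\<alpha>" using q by (simp add: ji defects_def)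
    then show ?thesis using 2 dot[OF jb] by simp
  next
    case 3
    then have *: "\<forall>B\<in>\<alpha>. Unprimed i \<in> B \<longleftrightarrow> Unprimed j \<in> B" using q by (simp add: ji defects_def)
    have "Unprimed i \<in> B \<longleftrightarrow> Unprimed j \<in> B" if "B \<in> ?P" for B
    proof (cases "Unprimed j \<in> \<Union>\<alpha>")
      case False
      then have "Unprimed i \<notin> \<Union>\<alpha>" using * by blast
      then have "Unprimed i \<notin> \<Union>?P" "Unprimed j \<notin> \<Union>?P"
        using False dot[of i] dot[of j] ib[OF 3(2)] jb by blast+
      then show ?thesis using that by blast
    next
      case True
      then obtain C where C: "C \<in> \<alpha>" "Unprimed j \<in> C" "Unprimed i \<in> C" using * by blast
      then have "primed_to_middle (Unprimed j) \<in> primed_to_middle ` C"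
        "primed_to_middle (Unprimed i) \<in> primed_to_middle ` C" by blast+
      then have e: "(Unprimed i, Unprimed j) \<in> ?G" "(Unprimed j, Unprimed i) \<in> ?G"
        unfolding product_graph_def using C(1) by auto
      obtain x where x: "B = {y \<in> boundary n - ?D. (x, y) \<in> ?G\<^sup>*}"
        using \<open>B \<in> ?P\<close> unfolding rook_mult_def by blast
      have "(x, Unprimed i) \<in> ?G\<^sup>* \<longleftrightarrow> (x, Unprimed j) \<in> ?G\<^sup>*"
        using e by (meson rtrancl.rtrancl_into_rtrancl)
      moreover have "Unprimed i \<in> ?D \<longleftrightarrow> Unprimed j \<in> ?D"
        unfolding product_dots_def using e jb ib[OF 3(2)]
        by (auto intro: converse_rtrancl_into_rtrancl)
      ultimately show ?thesis using x jb ib[OF 3(2)] by auto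
    qed
    then show ?thesis using 3 by simp
  qed
  then show "q \<in> defects n ?P" using idx by (simp add: ji defects_def)
qed

lemma generated_subset_singular:
  "generated_subsemigroup (rook_mult n) (generator n ` index_set n) \<subseteq> rook_partitions n - rook_units n"
proof
  fix \<alpha> assume "\<alpha> \<in> generated_subsemigroup (rook_mult n) (generator n ` index_set n)"
  then have "\<alpha> \<in> rook_partitions n \<and> defects n \<alpha> \<noteq> {}"
  proof induction
    case (generator a)
    then show ?case using generator_in_rook_partitions defects_generator by fastforce
  next
    case (product x y)
    then show ?case using rook_mult_closed defects_mult by blast
  qed
  then show "\<alpha> \<in> rook_partitions n - rook_units n" using unit_iff_no_defects by blast
qed

section \<open>Operations on labels by right multiplication\<close>

text \<open>The identity is adjoined as a common starting point. It is a unit, so a singular element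
  of this set lies in the subsemigroup itself.\<close>

definition generated_monoid :: "nat \<Rightarrow> vertex set set set" where
  "generated_monoid n =
     insert (identity n) (generated_subsemigroup (rook_mult n) (generator n ` index_set n))"

lemma generated_monoid_mult:
  assumes "x \<in> generated_monoid n" "q \<in> index_set n"
  shows "rook_mult n x (generator n q) \<in> generated_monoid n"
proof (cases "x = identity n")
  case True
  have "generator n q \<in> generated_monoid n"
    unfolding generated_monoid_def using assms(2) by (intro insertI2 generated_subsemigroup.generator imageI)
  then show ?thesis using True by (simp only: identity_mult[OF generator_in_rook_partitions])
next
  case False
  then have "x \<in> generated_subsemigroup (rook_mult n) (generator n ` index_set n)"
    using assms(1) by (simp add: generated_monoid_def)
  from generated_subsemigroup.product[OF this generated_subsemigroup.generator[OF imageI[OF assms(2)]]]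
  show ?thesis unfolding generated_monoid_def by (rule insertI2)
qed

lemma generated_monoid_cut:
  assumes "fibres n f \<in> generated_monoid n" "i \<in> {1..n}"
  shows "fibres n (f(Primed i := None)) \<in> generated_monoid n"
  using generated_monoid_mult[OF assms(1), of "(i, i)"] mult_cut_top[OF assms(2), of f] assms(2)
  by (auto simp: index_set_def)

lemma generated_monoid_dot:
  assumes "fibres n f \<in> generated_monoid n" "i \<in> {1..n}"
    and "\<And>x. x \<in> boundary n \<Longrightarrow> f x = Some s \<Longrightarrow> f x = f (Primed i)"
  shows "fibres n ((\<lambda>x. if f x = f (Primed i) then None else f x)(Primed i := Some s))
    \<in> generated_monoid n"
  using generated_monoid_mult[OF assms(1), of "(i, 0)"] mult_dot_top[of i n f s, OF assms(2,3)] assms(2)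
  by (auto simp: index_set_def)

lemma merge_commute: "merge n i j = merge n j i"
  unfolding merge_def by (rule fibres_cong) (auto elim!: boundaryE split: if_splits)

lemma generated_monoid_merge:
  assumes "fibres n f \<in> generated_monoid n" "i \<in> {1..n}" "j \<in> {1..n}" "i \<noteq> j" "f (Primed j) \<noteq> None"
  shows "fibres n (\<lambda>x. if f x = f (Primed j) then f (Primed i) else f x) \<in> generated_monoid n"
proof -
  \<comment> \<open>Only pairs with the smaller index second are generators; the symmetry of
    \<open>merge\<close> covers the other order.\<close>
  obtain q where "q \<in> index_set n" "generator n q = merge n i j"
  proof (cases "i < j")
    case True
    then show ?thesis using that[of "(j, i)"] assms by (auto simp: index_set_def)
  next
    case False
    then show ?thesis using that[of "(i, j)"] assms merge_commute[of n i j] by (auto simp: index_set_def)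
  qed
  then show ?thesis
    using generated_monoid_mult[OF assms(1)] mult_merge[OF assms(2,3), of f] assms(5) by metis
qed

lemma infinite_vertex_sets: "infinite (UNIV :: vertex set set)"
proof -
  have "inj (\<lambda>k. {Unprimed k})" by (auto simp: inj_def)
  then show ?thesis using finite_subset[OF subset_UNIV] finite_imageD infinite_UNIV_nat by blast
qed

lemma finite_boundary: "finite (boundary n)"
  by (simp add: boundary_def top_row_def bottom_row_def)

text \<open>Labels range over the infinite type of vertex sets, while finitely many occur on the
  boundary.\<close>

lemma fresh_label:
  fixes f :: "vertex \<Rightarrow> vertex set option"
  obtains s where "\<forall>x\<in>boundary n. f x \<noteq> Some s"
proof -
  have "finite {s. Some s \<in> f ` boundary n}"
    using finite_vimageI[of "f ` boundary n" Some] finite_boundary by (simp add: vimage_def)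
  then obtain s where "s \<notin> {s. Some s \<in> f ` boundary n}"
    using ex_new_if_finite[OF infinite_vertex_sets] by blast
  then show ?thesis using that[of s] by (metis imageI mem_Collect_eq)
qed

text \<open>Multiplying by \<open>dot_top\<close> kills the label but leaves a fresh one at
  \<open>Primed i\<close>; a subsequent \<open>cut_top\<close> removes it.\<close>

lemma generated_monoid_kill:
  fixes f :: "vertex \<Rightarrow> vertex set option"
  assumes "fibres n f \<in> generated_monoid n" "i \<in> {1..n}"
  shows "fibres n (\<lambda>x. if f x = f (Primed i) then None else f x) \<in> generated_monoid n"
proof -
  obtain s where s: "\<forall>x\<in>boundary n. f x \<noteq> Some s" by (rule fresh_label)
  let ?g = "\<lambda>x. if f x = f (Primed i) then None else f x"
  have "fibres n (?g(Primed i := Some s)) \<in> generated_monoid n"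
    by (rule generated_monoid_dot[OF assms]) (simp add: s)
  from generated_monoid_cut[OF this assms(2)]
  have "fibres n (?g(Primed i := Some s, Primed i := None)) \<in> generated_monoid n" .
  moreover have "?g(Primed i := Some s, Primed i := None) = ?g" by auto
  ultimately show ?thesis by simp
qed

text \<open>The order is reversed here: after \<open>cut_top\<close> the point
  \<open>Primed i\<close> is a dot, so \<open>dot_top\<close> has nothing left to kill and only
  installs \<open>s\<close>.\<close>

lemma generated_monoid_fresh:
  assumes "fibres n f \<in> generated_monoid n" "i \<in> {1..n}"
    and s: "\<And>x. x \<in> boundary n \<Longrightarrow> f x \<noteq> Some s"
  shows "fibres n (f(Primed i := Some s)) \<in> generated_monoid n"
proof -
  let ?g = "f(Primed i := None)"
  have "fibres n ((\<lambda>x. if ?g x = ?g (Primed i) then None else ?g x)(Primed i := Some s))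
      \<in> generated_monoid n"
    by (rule generated_monoid_dot[OF generated_monoid_cut[OF assms(1,2)] assms(2)])
      (use s in \<open>auto split: if_splits\<close>)
  moreover have "(\<lambda>x. if ?g x = ?g (Primed i) then None else ?g x)(Primed i := Some s)
      = f(Primed i := Some s)" by auto
  ultimately show ?thesis by simp
qed

text \<open>A fresh label at \<open>Primed i\<close> is held by that point alone, so merging it into
  the label of \<open>Primed j\<close> changes nothing else. Copying \<open>None\<close> is a
  cut.\<close>

lemma generated_monoid_copy:
  fixes f :: "vertex \<Rightarrow> vertex set option"
  assumes "fibres n f \<in> generated_monoid n" "i \<in> {1..n}" "j \<in> {1..n}"
  shows "fibres n (f(Primed i := f (Primed j))) \<in> generated_monoid n"
proof (cases "i = j \<or> f (Primed j) = None")
  case True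
  then show ?thesis using assms generated_monoid_cut[OF assms(1,2)] by auto
next
  case False
  obtain s where s: "\<forall>x\<in>boundary n. f x \<noteq> Some s" by (rule fresh_label)
  let ?g = "f(Primed i := Some s)"
  have g: "fibres n ?g \<in> generated_monoid n"
    by (rule generated_monoid_fresh[OF assms(1,2)]) (use s in blast)
  have "fibres n (\<lambda>x. if ?g x = ?g (Primed i) then ?g (Primed j) else ?g x) \<in> generated_monoid n"
    by (rule generated_monoid_merge[OF g assms(3,2)]) (use False in auto)
  moreover have "fibres n (\<lambda>x. if ?g x = ?g (Primed i) then ?g (Primed j) else ?g x)
      = fibres n (f(Primed i := f (Primed j)))"
    by (rule fibres_cong) (use False s in auto)
  ultimately show ?thesis by simp
qed

section \<open>Realising the top row\<close>

lemma rows_update: "(rows a b)(Primed i := v) = rows a (b(i := v))"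
proof
  fix x show "((rows a b)(Primed i := v)) x = rows a (b(i := v)) x"
    by (cases x) auto
qed

lemma fibres_rows_cong:
  assumes "\<And>k. k \<in> {1..n} \<Longrightarrow> a k = a' k" "\<And>k. k \<in> {1..n} \<Longrightarrow> b k = b' k"
  shows "fibres n (rows a b) = fibres n (rows a' b')"
proof -
  have "rows a b x = rows a' b' x" if "x \<in> boundary n" for x
    using that assms by (auto elim!: boundaryE)
  then show ?thesis by (intro fibres_cong) auto
qed

lemma fibres_diagonal_cong:
  assumes "\<And>k. k \<in> {1..n} \<Longrightarrow> a k = None \<longleftrightarrow> a' k = None"
    and "\<And>k m. k \<in> {1..n} \<Longrightarrow> m \<in> {1..n} \<Longrightarrow> a k = a m \<longleftrightarrow> a' k = a' m"
  shows "fibres n (rows a a) = fibres n (rows a' a')"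
  by (rule fibres_cong) (use assms in \<open>auto elim!: boundaryE\<close>)

text \<open>The labels \<open>{DPrimed k}\<close> serve as the labels of the identity, distinct from those of the
  target.\<close>

lemma diagonal_in_generated_monoid:
  fixes a :: "nat \<Rightarrow> vertex set option"
  assumes a: "\<And>k m. a k \<noteq> Some {DPrimed m}"
  shows "fibres n (rows a a) \<in> generated_monoid n"
proof -
  \<comment> \<open>The intermediate state: columns in \<open>S\<close> have their target label, the
    others still the label of the identity.\<close>
  define c where "c S k = (if k \<in> S then a k else Some {DPrimed k})" for S k
  have "fibres n (rows (c S) (c S)) \<in> generated_monoid n" if "finite S" "S \<subseteq> {1..n}" for S
    using that
  proof (induction S)
    case empty
    have "fibres n (rows (c {}) (c {})) = fibres n (rows Some Some)"
      by (rule fibres_cong) (auto simp: c_def elim!: boundaryE)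
    then show ?case by (simp add: generated_monoid_def identity_def)
  next
    case (insert i S)
    then have IH: "fibres n (rows (c S) (c S)) \<in> generated_monoid n" and i: "i \<in> {1..n}" "i \<notin> S"
      and S: "S \<subseteq> {1..n}" by auto
    have old: "c S k = c S i \<longleftrightarrow> k = i" for k using a[of k i] i by (auto simp: c_def)
    have upd: "c (insert i S) k = (if k = i then a i else c S k)" for k by (auto simp: c_def)
    \<comment> \<open>The private label of \<open>i\<close> is killed, merged into that of a
      processed column, or, if its target is new, merely renamed.\<close>
    consider "a i = None" | k where "k \<in> S" "a i = a k" "a i \<noteq> None"
      | "a i \<noteq> None" "\<And>k. k \<in> S \<Longrightarrow> a k \<noteq> a i" by metis
    then show ?case
    proof cases
      case 1
      let ?f = "rows (c S) (c S)"
      have "fibres n (\<lambda>x. if ?f x = ?f (Primed i) then None else ?f x) \<in> generated_monoid n"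
        by (rule generated_monoid_kill[OF IH i(1)])
      moreover have "(if ?f x = ?f (Primed i) then None else ?f x)
          = rows (c (insert i S)) (c (insert i S)) x" for x
        by (cases x) (simp_all add: old upd 1)
      ultimately show ?thesis by simp
    next
      case 2
      let ?f = "rows (c S) (c S)"
      have k: "k \<in> {1..n}" "c S k = a k" "k \<noteq> i" using 2 S i by (auto simp: c_def)
      have "?f (Primed i) \<noteq> None" using i by (simp add: c_def)
      then have "fibres n (\<lambda>x. if ?f x = ?f (Primed i) then ?f (Primed k) else ?f x) \<in> generated_monoid n"
        using IH i(1) k(1,3) by (intro generated_monoid_merge)
      moreover have "fibres n (\<lambda>x. if ?f x = ?f (Primed i) then ?f (Primed k) else ?f x)
          = fibres n (rows (c (insert i S)) (c (insert i S)))"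
      proof -
        have "(if ?f x = ?f (Primed i) then ?f (Primed k) else ?f x)
            = rows (c (insert i S)) (c (insert i S)) x" if "x \<in> boundary n" for x
          using that by (auto simp: old upd 2 k(2) elim!: boundaryE)
        then show ?thesis by (intro fibres_cong) simp_all
      qed
      ultimately show ?thesis by simp
    next
      case 3
      have new: "c S k = a i \<longleftrightarrow> False" if "k \<noteq> i" for k
        using 3(2)[of k] a[of i k] by (auto simp: c_def)
      have "fibres n (rows (c S) (c S)) = fibres n (rows (c (insert i S)) (c (insert i S)))"
      proof (rule fibres_diagonal_cong)
        fix k show "c S k = None \<longleftrightarrow> c (insert i S) k = None"
          using 3(1) i by (auto simp: c_def)
      next
        fix k m show "c S k = c S m \<longleftrightarrow> c (insert i S) k = c (insert i S) m"
          using old[of k] old[of m] new[of k] new[of m] by (auto simp: upd)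
      qed
      then show ?thesis using IH by simp
    qed
  qed
  from this[of "{1..n}"] have "fibres n (rows (c {1..n}) (c {1..n})) \<in> generated_monoid n" by simp
  moreover have "fibres n (rows (c {1..n}) (c {1..n})) = fibres n (rows a a)"
    by (rule fibres_rows_cong) (simp_all add: c_def)
  ultimately show ?thesis by simp
qed

section \<open>Moving the transversal labels along the bottom row\<close>

text \<open>Here \<open>q\<close> gives current and \<open>p\<close> intended positions. The
  induction is on the number of misplaced labels: a label is copied to its goal if no tracked label
  sits there; otherwise the occupant is first moved to a spare point, which exists because
  \<open>card L < n\<close>.\<close>

lemma relocate:
  fixes a b :: "nat \<Rightarrow> vertex set option"
  assumes L: "finite L" "card L < n"
    and p: "inj_on p L" "p ` L \<subseteq> {1..n}"
    and q: "inj_on q L" "q ` L \<subseteq> {1..n}"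
    and b: "fibres n (rows a b) \<in> generated_monoid n" "\<And>v. v \<in> L \<Longrightarrow> b (q v) = v"
  shows "\<exists>b'. fibres n (rows a b') \<in> generated_monoid n \<and> (\<forall>v\<in>L. b' (p v) = v)"
  using q b
proof (induction "card {v \<in> L. q v \<noteq> p v}" arbitrary: q b rule: less_induct)
  case less
  have fin: "finite {v \<in> L. q v \<noteq> p v}" using L(1) by simp
  have copy: "fibres n (rows a (b(i := b j))) \<in> generated_monoid n"
    if "fibres n (rows a b) \<in> generated_monoid n" "i \<in> {1..n}" "j \<in> {1..n}" for b :: "nat \<Rightarrow> vertex set option" and i j
    using generated_monoid_copy[OF that] by (simp add: rows_update)
  show ?case
  proof (cases "\<forall>v\<in>L. q v = p v")
    case True
    then show ?thesis using less.prems by metis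
  next
    case False
    then obtain v where v: "v \<in> L" "q v \<noteq> p v" by blast
    have pv: "p v \<in> {1..n}" "q v \<in> {1..n}" using v p less.prems by auto
    show ?thesis
    proof (cases "p v \<in> q ` L")
      case False
      let ?q = "q(v := p v)" and ?b = "b(p v := b (q v))"
      show ?thesis
      proof (rule less.hyps)
        have "{u \<in> L. ?q u \<noteq> p u} \<subset> {u \<in> L. q u \<noteq> p u}" using v by auto
        then show "card {u \<in> L. ?q u \<noteq> p u} < card {u \<in> L. q u \<noteq> p u}"
          by (rule psubset_card_mono[OF fin])
        show "inj_on ?q L" by (rule inj_on_fun_updI[OF less.prems(1) False])
        show "?q ` L \<subseteq> {1..n}" using less.prems(2) pv by auto
        show "fibres n (rows a ?b) \<in> generated_monoid n" by (rule copy[OF less.prems(3) pv])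
        show "?b (?q u) = u" if "u \<in> L" for u
        proof -
          have "q u \<noteq> p v" using False that by (metis imageI)
          then show ?thesis using that less.prems(4) v by simp
        qed
      qed
    next
      case True
      then obtain w where w: "w \<in> L" "q w = p v" by force
      have "w \<noteq> v" using w v by auto
      \<comment> \<open>The occupant \<open>w\<close> was already misplaced, so moving it to
        \<open>h\<close> does not raise the count, while \<open>v\<close> reaches its goal.\<close>
      then have wp: "q w \<noteq> p w" using w v p(1) by (auto dest: inj_onD)
      have "card (q ` L) < card {1..n}" using card_image[OF less.prems(1)] L(2) by simp
      then obtain h where h: "h \<in> {1..n}" "h \<notin> q ` L"
        by (metis card_mono finite_imageI L(1) not_less subsetI)
      \<comment> \<open>First \<open>w\<close> is copied from \<open>p v\<close> to
        \<open>h\<close>, then \<open>v\<close> from \<open>q v\<close> to \<open>p v\<close>. The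
        second copy still reads \<open>v\<close>, as \<open>h\<close> differs from
        \<open>q v\<close>.\<close>
      let ?q = "q(w := h, v := p v)" and ?b = "(b(h := b (p v)))(p v := (b(h := b (p v))) (q v))"
      have hv: "h \<noteq> p v" "h \<noteq> q v" using h True v by auto
      show ?thesis
      proof (rule less.hyps)
        have "{u \<in> L. ?q u \<noteq> p u} \<subset> {u \<in> L. q u \<noteq> p u}" using v w wp by auto
        then show "card {u \<in> L. ?q u \<noteq> p u} < card {u \<in> L. q u \<noteq> p u}"
          by (rule psubset_card_mono[OF fin])
        have qu: "q u \<noteq> p v" if "u \<in> L" "u \<noteq> w" for u
          using less.prems(1) w that by (metis inj_onD)
        have qh: "q u \<noteq> h" if "u \<in> L" for u using that h by (metis imageI)
        have "p v \<notin> (q(w := h)) ` L"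
        proof
          assume "p v \<in> (q(w := h)) ` L"
          then obtain u where "u \<in> L" "p v = (q(w := h)) u" by blast
          then show False using hv(1) qu[of u] by (cases "u = w") simp_all
        qed
        then show "inj_on ?q L"
          by (intro inj_on_fun_updI less.prems(1) h(2))
        show "?b (?q u) = u" if u: "u \<in> L" for u
        proof -
          consider "u = v" | "u = w" "u \<noteq> v" | "u \<noteq> v" "u \<noteq> w" by blast
          then show ?thesis
          proof cases
            case 1
            then show ?thesis using hv(2) less.prems(4)[OF v(1)] by simp
          next
            case 2
            then show ?thesis using hv(1) w less.prems(4)[OF w(1)] by simp
          next
            case 3
            then show ?thesis using qu[OF u] qh[OF u] less.prems(4)[OF u] by simp
          qed
        qed
        show "?q ` L \<subseteq> {1..n}" using less.prems(2) pv h by auto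
        show "fibres n (rows a ?b) \<in> generated_monoid n"
          by (intro copy less.prems(3) pv h(1))
      qed
    qed
  qed
qed

section \<open>Clearing and filling the bottom row\<close>

lemma clear_bottom:
  assumes "fibres n (rows a b) \<in> generated_monoid n" "finite S" "S \<subseteq> {1..n}"
  shows "fibres n (rows a (\<lambda>k. if k \<in> S then None else b k)) \<in> generated_monoid n"
  using assms(2,3)
proof (induction S)
  case empty
  then show ?case using assms(1) by simp
next
  case (insert i S)
  then have "fibres n ((rows a (\<lambda>k. if k \<in> S then None else b k))(Primed i := None)) \<in> generated_monoid n"
    by (intro generated_monoid_cut) auto
  moreover have "(\<lambda>k. if k \<in> S then None else b k)(i := None) = (\<lambda>k. if k \<in> insert i S then None else b k)"
    by auto
  ultimately show ?case by (simp add: rows_update)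
qed

text \<open>The points of \<open>R\<close> regain their labels one by one, by doing nothing, by
  copying, or by a fresh label. The last is legitimate only if the label is absent from the top row
  too; \<open>shared\<close> ensures this, since a label common to both rows has a bottom point that
  was never cleared.\<close>

lemma fill_bottom:
  fixes a b :: "nat \<Rightarrow> vertex set option"
  assumes start: "fibres n (rows a (\<lambda>k. if k \<in> R then None else b k)) \<in> generated_monoid n"
    and R: "R \<subseteq> {1..n}"
    and shared: "\<And>k m. k \<in> {1..n} \<Longrightarrow> m \<in> {1..n} \<Longrightarrow> a k = b m \<Longrightarrow> a k \<noteq> None \<Longrightarrow>
      \<exists>j\<in>{1..n} - R. b j = a k"
  shows "fibres n (rows a b) \<in> generated_monoid n"
proof -
  define c where "c S k = (if k \<in> R - S then None else b k)" for S k
  have "fibres n (rows a (c S)) \<in> generated_monoid n" if "finite S" "S \<subseteq> R" for S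
    using that
  proof (induction S)
    case empty
    then show ?case using start by (simp add: c_def[abs_def])
  next
    case (insert i S)
    then have IH: "fibres n (rows a (c S)) \<in> generated_monoid n" and i: "i \<in> {1..n}" "i \<in> R" "i \<notin> S"
      using R by auto
    have upd: "c (insert i S) = (c S)(i := b i)" using i by (auto simp: c_def)
    consider "b i = None" | j where "j \<in> {1..n}" "b i = c S j"
      | s where "b i = Some s" "\<And>j. j \<in> {1..n} \<Longrightarrow> b i \<noteq> c S j"
      by (metis option.exhaust)
    then show ?case
    proof cases
      case 1
      then have "c (insert i S) = c S" using i by (auto simp: c_def)
      then show ?thesis using IH by simp
    next
      case 2
      then show ?thesis
        using generated_monoid_copy[OF IH i(1) 2(1)] by (simp only: rows_update rows.simps upd)
    next
      case 3
      have "rows a (c S) x \<noteq> Some s" if "x \<in> boundary n" for x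
        using that
      proof (cases rule: boundaryE)
        case (1 k)
        \<comment> \<open>Otherwise \<open>shared\<close> gives a point outside \<open>R\<close>
          with label \<open>s\<close>, against the absence of \<open>s\<close> from the current
          bottom row.\<close>
        have "a k \<noteq> Some s"
        proof
          assume "a k = Some s"
          then obtain j where "j \<in> {1..n} - R" "b j = Some s"
            using shared[of k i] 1 i 3 by auto
          then show False using 3(1) 3(2)[of j] by (auto simp: c_def)
        qed
        then show ?thesis by (simp add: 1)
      next
        case (2 k)
        then show ?thesis using 3(1) 3(2)[of k] by auto
      qed
      from generated_monoid_fresh[OF IH i(1) this] show ?thesis
        by (simp only: rows_update upd 3(1))
    qed
  qed
  from this[of R] have "fibres n (rows a (c R)) \<in> generated_monoid n"
    using R finite_subset by blast
  moreover have "c R = b" by (auto simp: c_def)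
  ultimately show ?thesis by simp
qed

section \<open>Generation of the singular part\<close>

lemma identity_unit: "identity n \<in> rook_units n"
proof -
  have "shared_labels n (rows Some Some) = Some ` {1..n}" by (auto simp: shared_labels_def)
  then show ?thesis by (simp add: identity_def fibres_unit_iff card_image)
qed

lemma singular_generated:
  assumes "\<alpha> \<in> rook_partitions n - rook_units n"
  shows "\<alpha> \<in> generated_subsemigroup (rook_mult n) (generator n ` index_set n)"
proof -
  obtain f :: "vertex \<Rightarrow> vertex set option" where \<alpha>: "\<alpha> = fibres n f"
    and lab: "\<And>x B. f x = Some B \<Longrightarrow> B \<subseteq> boundary n"
    using rook_partition_as_fibres assms by (metis DiffD1)
  define a where "a k = f (Unprimed k)" for k
  define b where "b k = f (Primed k)" for k
  define L where "L = shared_labels n f"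
  have "\<alpha> = fibres n (rows a b)"
    unfolding \<alpha> by (rule fibres_cong) (auto simp: a_def b_def elim!: boundaryE)
  \<comment> \<open>Singularity enters here: fewer than \<open>n\<close> transversal labels leave a
    spare bottom point.\<close>
  have L: "finite L" "card L < n"
    using assms card_shared_labels_le[of n f] finite_shared_labels[of n f] fibres_unit_iff[of n f]
    by (auto simp: L_def \<alpha>)
  have "\<exists>p. \<forall>v\<in>L. p v \<in> {1..n} \<and> b (p v) = v"
    by (rule bchoice) (auto simp: L_def shared_labels_def b_def)
  then obtain p where p: "\<And>v. v \<in> L \<Longrightarrow> p v \<in> {1..n}" "\<And>v. v \<in> L \<Longrightarrow> b (p v) = v" by blast
  \<comment> \<open>In \<open>rows a a\<close> the bottom row repeats the top row, so a top position
    \<open>q v\<close> is also a bottom position of \<open>v\<close>, from which the relocation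
    starts.\<close>
  have "\<exists>q. \<forall>v\<in>L. q v \<in> {1..n} \<and> a (q v) = v"
    by (rule bchoice) (auto simp: L_def shared_labels_def a_def)
  then obtain q where q: "\<And>v. v \<in> L \<Longrightarrow> q v \<in> {1..n}" "\<And>v. v \<in> L \<Longrightarrow> a (q v) = v" by blast
  have "fibres n (rows a a) \<in> generated_monoid n"
    using lab[of _ "{DPrimed m}" for m] by (intro diagonal_in_generated_monoid) (auto simp: a_def)
  moreover have "inj_on p L" "inj_on q L" using p(2) q(2) by (metis inj_onI)+
  ultimately obtain b' where b': "fibres n (rows a b') \<in> generated_monoid n" "\<And>v. v \<in> L \<Longrightarrow> b' (p v) = v"
    using relocate[OF L, of p q a a] p(1) q by blast
  define R where "R = {1..n} - p ` L"
  have "fibres n (rows a (\<lambda>k. if k \<in> R then None else b' k)) \<in> generated_monoid n"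
    using b'(1) by (rule clear_bottom) (auto simp: R_def)
  \<comment> \<open>The points outside \<open>R\<close> are the chosen positions \<open>p v\<close>,
    where \<open>b'\<close> and \<open>b\<close> both have the label \<open>v\<close>.\<close>
  also have "fibres n (rows a (\<lambda>k. if k \<in> R then None else b' k))
      = fibres n (rows a (\<lambda>k. if k \<in> R then None else b k))"
    by (rule fibres_rows_cong) (auto simp: R_def b'(2) p(2))
  finally have "fibres n (rows a b) \<in> generated_monoid n"
  proof (rule fill_bottom)
    fix k m assume "k \<in> {1..n}" "m \<in> {1..n}" "a k = b m" "a k \<noteq> None"
    then have "a k \<in> L" unfolding L_def shared_labels_def a_def b_def by (metis (mono_tags, lifting) mem_Collect_eq)
    then show "\<exists>j\<in>{1..n} - R. b j = a k" using p by (intro bexI[of _ "p (a k)"]) (auto simp: R_def)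
  qed (simp add: R_def)
  then have "\<alpha> \<in> generated_monoid n" using \<open>\<alpha> = fibres n (rows a b)\<close> by simp
  moreover have "\<alpha> \<noteq> identity n" using assms identity_unit by auto
  ultimately show ?thesis by (simp add: generated_monoid_def)
qed

section \<open>The lower bound and the ranks\<close>

lemma card_generating_set:
  assumes "finite A" "A \<subseteq> rook_partitions n - rook_units n"
    and gen: "generated_subsemigroup (rook_mult n) A = rook_partitions n - rook_units n"
  shows "card (index_set n) \<le> card A"
proof -
  \<comment> \<open>The witness is the leftmost factor of a product of elements of
    \<open>A\<close>.\<close>
  have left_factor: "x \<in> rook_partitions n \<and> (\<exists>a\<in>A. defects n a \<subseteq> defects n x)"
    if "x \<in> generated_subsemigroup (rook_mult n) A" for x
    using that
  proof induction
    case (generator a)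
    then show ?case using assms(2) by auto
  next
    case (product x y)
    then show ?case using rook_mult_closed defects_mult by blast
  qed
  have "{q} \<in> defects n ` A" if q: "q \<in> index_set n" for q
  proof -
    have "generator n q \<in> generated_subsemigroup (rook_mult n) A"
      unfolding gen using unit_iff_no_defects[OF generator_in_rook_partitions, of n q]
      by (simp add: generator_in_rook_partitions defects_generator[OF q])
    then obtain a where a: "a \<in> A" "defects n a \<subseteq> {q}"
      using left_factor defects_generator[OF q] by metis
    \<comment> \<open>Being singular, \<open>a\<close> has a defect, so its defect set is exactly
      \<open>{q}\<close>.\<close>
    moreover have "defects n a \<noteq> {}" using a(1) assms(2) unit_iff_no_defects by blast
    ultimately show ?thesis by blast
  qed
  then have "(\<lambda>q. {q}) ` index_set n \<subseteq> defects n ` A" by blast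
  then have "card ((\<lambda>q. {q}) ` index_set n) \<le> card (defects n ` A)"
    using assms(1) by (intro card_mono) auto
  also have "\<dots> \<le> card A" by (rule card_image_le[OF assms(1)])
  finally show ?thesis by (simp add: card_image)
qed

theorem theorem3p15:
  fixes n :: nat
  shows "semigroup_rank (rook_mult n) (rook_partitions n - rook_units n)
           = semigroup_idrank (rook_mult n) (rook_partitions n - rook_units n)
       \<and> semigroup_idrank (rook_mult n) (rook_partitions n - rook_units n)
           = enat ((n\<^sup>2 + 3 * n) div 2)"
proof -
  let ?S = "rook_partitions n - rook_units n" and ?A = "generator n ` index_set n"
  let ?N = "enat ((n\<^sup>2 + 3 * n) div 2)"
  have gen: "generated_subsemigroup (rook_mult n) ?A = ?S"
    using generated_subset_singular singular_generated by blast
  have "finite ?A" by (simp add: index_set_def)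
  moreover have "?A \<subseteq> ?S" using gen by (metis generated_subsemigroup.generator subsetI)
  moreover have "\<forall>e\<in>?A. rook_mult n e e = e" using generator_idempotent by blast
  moreover have "card ?A = (n\<^sup>2 + 3 * n) div 2"
  proof -
    \<comment> \<open>The defect set of a generator recovers its index.\<close>
    have "inj_on (generator n) (index_set n)"
      using defects_generator by (metis inj_onI singleton_inject)
    then show ?thesis by (simp add: card_image card_index_set)
  qed
  ultimately have upper: "semigroup_rank (rook_mult n) ?S \<le> ?N" "semigroup_idrank (rook_mult n) ?S \<le> ?N"
    unfolding semigroup_rank_def semigroup_idrank_def using gen
    by (intro Inf_lower CollectI exI[of _ ?A]; simp)+
  have lower: "?N \<le> enat (card A)"
    if "finite A" "A \<subseteq> ?S" "generated_subsemigroup (rook_mult n) A = ?S" for A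
    using card_generating_set[OF that] by (simp add: card_index_set)
  have "?N \<le> semigroup_rank (rook_mult n) ?S" "?N \<le> semigroup_idrank (rook_mult n) ?S"
    unfolding semigroup_rank_def semigroup_idrank_def by (rule Inf_greatest; use lower in blast)+
  with upper show ?thesis by (metis antisym)
qed

end
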